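(* Let $g$ be a Gårding polynomial of degree $N\ge1$ on a finite-dimensional real vector space $V$ with Gårding cone $\Gamma$, let $\Gamma^*$ be the open polar, $g^*:\Gamma^*\to\mathbb{R}$ the dual Gårding function, $f=\log g$ on $\Gamma$ the potential and $f^*=\log g^*$ on $\Gamma^*$ the dual potential. Suppose $x\in\Gamma$ and $y\in\Gamma^*$ correspond, that is, $y=F(x)=D_x\log g$. Then $$g(x)\,g^*(y)=1,\qquad f(x)+f^*(y)=0,\qquad \langle x,y\rangle=N .$$
   Context: A Gårding polynomial of degree $N$ on a finite-dimensional real vector space $V$ is a homogeneous real polynomial $g$ of degree $N$ on $V$ together with a connected component $\Gamma$ of $\{g>0\}$ (the Gårding cone) such that for some $e\in\Gamma$ and every $v\in V$ the polynomial $t\mapsto g(te+v)$ has exactly $N$ real roots counted with multiplicity. The cone $\Gamma$ is then open and convex. Its edge is the linear subspace $E=\overline\Gamma\cap(-\overline\Gamma)$, and $g(x+v)=g(x)$ for all $x\in V$, $v\in E$. The polar is $\Gamma^0=\{y\in V^*:\langle y,x\rangle\ge0\ \forall x\in\Gamma\}$; the open polar $\Gamma^*$ is the interior of $\Gamma^0$ relative to its linear span $S\subset V^*$ (the annihilator of $E$). For $x\in\Gamma$ put $F(x)=D_x\log g\in V^*$. This depends only on the class of $x$ in $\Gamma/E$, and $F$ induces a bijection $\Gamma/E\to\Gamma^*$. The dual Gårding function is $g^*(y)=1/g(x)$ for $y\in\Gamma^*$, where $x\in\Gamma$ is any point with $F(x)=y$. *)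

theory Defs
  imports "HOL-Analysis.Analysis" "HOL-Computational_Algebra.Polynomial"
begin

text \<open>
  A finite-dimensional real vector space \<open>V\<close> is a type of class \<^class>\<open>euclidean_space\<close>; its inner
  product plays no role beyond inducing the standard topology. The dual \<open>V\<^sup>*\<close> is the space
  \<open>'a \<Rightarrow>\<^sub>L real\<close> of (automatically continuous) linear functionals, and the pairing of \<open>y\<close> with \<open>x\<close>
  is \<open>blinfun_apply y x\<close>.
\<close>

text \<open>
  Over the infinite field of reals, polynomials on \<open>V\<close> are the same as polynomial functions, and
  homogeneity of degree \<open>N\<close> is the functional equation below.
\<close>

definition homogeneous_polynomial :: "nat \<Rightarrow> ('a::euclidean_space \<Rightarrow> real) \<Rightarrow> bool" where
  "homogeneous_polynomial N g \<longleftrightarrow>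
     real_polynomial_function g \<and> (\<forall>c x. g (c *\<^sub>R x) = c ^ N * g x)"

definition garding_polynomial :: "nat \<Rightarrow> ('a::euclidean_space \<Rightarrow> real) \<Rightarrow> 'a set \<Rightarrow> bool" where
  "garding_polynomial N g \<Gamma> \<longleftrightarrow>
     homogeneous_polynomial N g \<and>
     \<Gamma> \<in> components {x. g x > 0} \<and>
     (\<exists>e\<in>\<Gamma>. \<forall>v. \<exists>p :: real poly.
        p \<noteq> 0 \<and> (\<forall>t. poly p t = g (t *\<^sub>R e + v)) \<and>
        (\<Sum>t\<in>{t. poly p t = 0}. order t p) = N)"

definition polar :: "'a::euclidean_space set \<Rightarrow> ('a \<Rightarrow>\<^sub>L real) set" where
  "polar \<Gamma> = {y. \<forall>x\<in>\<Gamma>. blinfun_apply y x \<ge> 0}"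

definition open_polar :: "'a::euclidean_space set \<Rightarrow> ('a \<Rightarrow>\<^sub>L real) set" where
  "open_polar \<Gamma> = top_of_set (span (polar \<Gamma>)) interior_of polar \<Gamma>"

definition potential :: "('a::euclidean_space \<Rightarrow> real) \<Rightarrow> 'a \<Rightarrow> real" where
  "potential g x = ln (g x)"

definition log_differential :: "('a::euclidean_space \<Rightarrow> real) \<Rightarrow> 'a \<Rightarrow> ('a \<Rightarrow>\<^sub>L real)" where
  "log_differential g x = Blinfun (frechet_derivative (potential g) (at x))"

text \<open>
  The definite description reflects that \<open>1 / g x\<close> does not depend on the choice of \<open>x \<in> \<Gamma>\<close> above
  \<open>y\<close>. The value is only meaningful for \<open>y \<in> open_polar \<Gamma>\<close>.
\<close>

definition dual_garding :: "('a::euclidean_space \<Rightarrow> real) \<Rightarrow> 'a set \<Rightarrow> ('a \<Rightarrow>\<^sub>L real) \<Rightarrow> real" where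
  "dual_garding g \<Gamma> y = (THE c. \<exists>x\<in>\<Gamma>. log_differential g x = y \<and> c = 1 / g x)"

definition dual_potential :: "('a::euclidean_space \<Rightarrow> real) \<Rightarrow> 'a set \<Rightarrow> ('a \<Rightarrow>\<^sub>L real) \<Rightarrow> real" where
  "dual_potential g \<Gamma> y = ln (dual_garding g \<Gamma> y)"

end

theory Submission
  imports Defs "HOL-Computational_Algebra.Fundamental_Theorem_Algebra"
begin

text \<open>
  The three identities are immediate once the dual function is known to be well-defined: Euler's identity
  gives the pairing \<open>N\<close>, and the other two identities say that \<open>g\<^sup>*(y) = 1/g(x)\<close>.
  What has to be proved is that \<open>g(x) = g(x')\<close> whenever two points \<open>x\<close> and \<open>x'\<close> of the cone have the same
  logarithmic differential.

  Suppose that \<open>g(x + sx') = g(x) (1 + s l\<^sub>1) \<dots> (1 + s l\<^sub>N)\<close> with positive \<open>l\<^sub>i\<close>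
  (\<open>garding_cone_factorization\<close>). Then \<open>\<langle>x', F(x)\<rangle>\<close> is the sum of the \<open>l\<^sub>i\<close>, and \<open>g(x')/g(x)\<close> is
  their product. If \<open>F(x) = F(x')\<close>, Euler's identity at \<open>x'\<close> shows that the sum is \<open>N\<close>, so the product is
  at most \<open>1\<close> by the arithmetic-geometric mean inequality. Thus \<open>g(x') \<le> g(x)\<close>, and equality follows by
  symmetry.

  The factorization rests on Garding's theorem that \<open>g\<close> is hyperbolic not only in the given direction \<open>e\<close> but
  in every direction \<open>a\<close> of the cone (\<open>garding_cone_hyperbolic\<close>). Its proof extends \<open>g\<close>, restricted
  to the span of \<open>e\<close>, \<open>a\<close> and \<open>v\<close>, to a form \<open>G(s, t, u)\<close> in complex variables and follows the roots \<open>t\<close> of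
  \<open>G(\<i>, t, u)\<close>: they never meet the real axis for real \<open>u\<close> and start in the lower half-plane at \<open>u = 0\<close>
  (\<open>garding_cone_nonvanishing\<close>). Both this and the fact that the rays \<open>te + x\<close> with \<open>t \<ge> 0\<close> stay
  inside \<open>{g > 0}\<close> (\<open>garding_cone_starlike\<close>) are connectedness arguments. In both, openness comes from projecting along a
  compact set, and closedness from the lower bound of a polynomial by its leading coefficient and the
  distances to its roots (\<open>norm_poly_ge_root_distance\<close>).
\<close>

section \<open>Complex polynomials and their roots\<close>

lemma complex_poly_eqI_real:
  fixes p q :: "complex poly"
  assumes "\<And>t::real. poly p (of_real t) = poly q (of_real t)"
  shows "p = q"
proof (rule ccontr)
  assume "p \<noteq> q"
  hence "finite {z. poly (p - q) z = 0}"
    by (intro poly_roots_finite) simp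
  moreover have "range complex_of_real \<subseteq> {z. poly (p - q) z = 0}"
    using assms by auto
  ultimately have "finite (range complex_of_real)"
    by (rule rev_finite_subset)
  thus False
    using finite_imageD[of complex_of_real UNIV] infinite_UNIV_char_0[where 'a=real]
    by (auto simp: inj_on_def)
qed

lemma poly_map_poly_of_real:
  "poly (map_poly complex_of_real p) (of_real t) = of_real (poly p t)"
  by (induction p) (auto simp: map_poly_pCons)

text \<open>
  A root count of \<open>proots\<close> equal to the degree leaves no room for further complex roots: splitting
  off one real linear factor at a time ends in a non-zero constant.
\<close>

lemma split_real_poly_roots_real:
  fixes p :: "real poly" and z :: complex
  assumes "p \<noteq> 0" "size (proots p) = degree p" "poly (map_poly of_real p) z = 0"
  shows "z \<in> \<real>"
  using assms
proof (induction "degree p" arbitrary: p)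
  case 0
  then obtain c where "p = [:c:]" "c \<noteq> 0"
    by (metis degree_eq_zeroE pCons_0_0)
  with 0 show ?case by (simp add: map_poly_pCons)
next
  case (Suc n)
  then have "proots p \<noteq> {#}" by auto
  then obtain r where "r \<in># proots p" by blast
  with Suc have "poly p r = 0" by simp
  then obtain q where q: "p = [:-r, 1:] * q"
    by (auto simp: poly_eq_0_iff_dvd)
  have "q \<noteq> 0" using q Suc by auto
  have "degree p = Suc (degree q)"
    unfolding q using \<open>q \<noteq> 0\<close> by (subst degree_mult_eq) auto
  moreover have "size (proots p) = Suc (size (proots q))"
    unfolding q using \<open>q \<noteq> 0\<close> by (subst proots_mult) auto
  moreover have "map_poly complex_of_real p = [:-of_real r, 1:] * map_poly of_real q"
    by (rule complex_poly_eqI_real, subst poly_mult)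
       (simp add: poly_map_poly_of_real q algebra_simps)
  ultimately have "z = of_real r \<or> poly (map_poly of_real q) z = 0"
    and "n = degree q" "size (proots q) = degree q"
    using Suc.hyps(2) Suc.prems by auto
  with Suc.hyps(1)[of q] \<open>q \<noteq> 0\<close> show ?case by (elim disjE) simp_all
qed

text \<open>
  The degree of \<open>p\<close> can be read off from \<open>p(z) = z\<^sup>N r(1/z)\<close>: after multiplication by
  \<open>z\<close> to the power of the degree of \<open>r\<close> this becomes an identity between \<open>p\<close> and the reflection of \<open>r\<close>
  up to powers of \<open>z\<close>, and the degree of the reflection is that of \<open>r\<close> because \<open>r(0) \<noteq> 0\<close>.
\<close>

lemma poly_reversal_degree:
  fixes p r :: "complex poly"
  assumes "\<And>z. z \<noteq> 0 \<Longrightarrow> poly p z = z ^ N * poly r (inverse z)" and "poly r 0 \<noteq> 0"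
  shows "degree p = N" "lead_coeff p = poly r 0"
proof -
  have eq: "z ^ degree r * poly p z = z ^ N * poly (reflect_poly r) z" if "z \<noteq> 0" for z
    using that assms(1)[OF that] by (simp add: poly_reflect_poly_nz)
  have inf: "infinite (UNIV - {0::complex})"
    by (simp add: infinite_UNIV_char_0)
  have "monom 1 (degree r) * p - monom 1 N * reflect_poly r = 0"
  proof (rule ccontr)
    assume "\<not> ?thesis"
    from poly_roots_finite[OF this]
    have "finite {z. poly (monom 1 (degree r) * p - monom 1 N * reflect_poly r) z = 0}" .
    moreover have "UNIV - {0} \<subseteq> {z. poly (monom 1 (degree r) * p - monom 1 N * reflect_poly r) z = 0}"
      using eq by (auto simp: poly_monom)
    ultimately show False
      using inf finite_subset by blast
  qed
  hence *: "monom 1 (degree r) * p = monom 1 N * reflect_poly r" by simp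
  have r0: "coeff r 0 \<noteq> 0" using assms(2) by (simp add: poly_0_coeff_0)
  hence "r \<noteq> 0" by auto
  with * have "p \<noteq> 0" by (auto simp: monom_eq_0_iff)
  from arg_cong[OF *, of degree] show "degree p = N"
    using r0 \<open>p \<noteq> 0\<close> \<open>r \<noteq> 0\<close> by (simp add: degree_mult_eq degree_monom_eq monom_eq_0_iff)
  from arg_cong[OF *, of lead_coeff] show "lead_coeff p = poly r 0"
    using r0 reflect_poly_reflect_poly[OF r0] coeff_0_reflect_poly[of "reflect_poly r"]
    by (simp add: lead_coeff_mult lead_coeff_monom degree_monom_eq poly_0_coeff_0)
qed

text \<open>
  This does the work of a theorem on continuity of roots. It turns the statement that all roots keep a certain
  distance from \<open>z\<close> into a weak inequality for the value at \<open>z\<close>, and such inequalities pass to limits.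
\<close>

lemma norm_poly_ge_root_distance:
  fixes p :: "complex poly"
  assumes "d \<ge> 0" and "\<And>w. poly p w = 0 \<Longrightarrow> d \<le> cmod (z - w)"
  shows "cmod (lead_coeff p) * d ^ degree p \<le> cmod (poly p z)"
proof (cases "p = 0")
  case False
  have "d ^ size M \<le> cmod (poly (\<Prod>x\<in>#M. [:-x, 1:]) z)"
    if "\<And>w. w \<in># M \<Longrightarrow> d \<le> cmod (z - w)" for M
    using that
  proof (induction M)
    case (add x M)
    have "d * d ^ size M \<le> cmod (z - x) * cmod (poly (\<Prod>x\<in>#M. [:-x, 1:]) z)"
      using add assms(1) by (intro mult_mono) auto
    also have "\<dots> = cmod ((z - x) * poly (\<Prod>x\<in>#M. [:-x, 1:]) z)"
      by (simp only: norm_mult)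
    finally show ?case by (simp add: algebra_simps)
  qed simp
  from this[of "proots p"] have "d ^ degree p \<le> cmod (poly (\<Prod>x\<in>#proots p. [:-x, 1:]) z)"
    using assms(2) False by (simp add: size_proots_complex)
  hence "cmod (lead_coeff p) * d ^ degree p \<le>
      cmod (poly (smult (lead_coeff p) (\<Prod>x\<in>#proots p. [:-x, 1:])) z)"
    by (simp add: norm_mult mult_left_mono)
  thus ?thesis by (simp only: complex_poly_decompose_multiset)
qed simp

section \<open>Complexification along three directions\<close>

text \<open>
  Polynomiality in three complex variables is encoded as continuity together with polynomiality along
  every complex line. This is all that root counting needs, and it is stable under sums and products
  without any bookkeeping of coefficients.
\<close>

definition ternary_polynomial :: "(complex \<Rightarrow> complex \<Rightarrow> complex \<Rightarrow> complex) \<Rightarrow> bool" where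
  "ternary_polynomial G \<longleftrightarrow>
     continuous_on UNIV (\<lambda>(s, t, u). G s t u) \<and>
     (\<forall>s s' t t' u u'. \<exists>p. \<forall>z. poly p z = G (s + z * s') (t + z * t') (u + z * u'))"

definition ternary_form :: "nat \<Rightarrow> (complex \<Rightarrow> complex \<Rightarrow> complex \<Rightarrow> complex) \<Rightarrow> bool" where
  "ternary_form N G \<longleftrightarrow>
     ternary_polynomial G \<and> (\<forall>c s t u. G (c * s) (c * t) (c * u) = c ^ N * G s t u)"

lemma ternary_polynomial_line:
  "ternary_polynomial G \<Longrightarrow> \<exists>p. \<forall>z. poly p z = G (s + z * s') (t + z * t') (u + z * u')"
  unfolding ternary_polynomial_def by simp

lemma ternary_polynomial_const: "ternary_polynomial (\<lambda>s t u. c)"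
proof -
  have "\<exists>p. \<forall>z::complex. poly p z = c"
    by (rule exI[of _ "[:c:]"]) simp
  thus ?thesis by (simp add: ternary_polynomial_def case_prod_unfold)
qed

lemma ternary_polynomial_linear: "ternary_polynomial (\<lambda>s t u. s * a + t * b + u * c)"
proof -
  have "\<exists>p. \<forall>z. poly p z = (s + z * s') * a + (t + z * t') * b + (u + z * u') * c" for s s' t t' u u'
    by (rule exI[of _ "[:s * a + t * b + u * c, s' * a + t' * b + u' * c:]"])
      (simp add: algebra_simps)
  thus ?thesis
    by (auto simp: ternary_polynomial_def case_prod_unfold intro!: continuous_on_add
        continuous_on_mult continuous_on_fst continuous_on_snd continuous_on_id continuous_on_const)
qed

lemma ternary_polynomial_add:
  assumes "ternary_polynomial F" "ternary_polynomial G"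
  shows "ternary_polynomial (\<lambda>s t u. F s t u + G s t u)"
proof -
  have "\<exists>p. \<forall>z. poly p z =
      F (s + z * s') (t + z * t') (u + z * u') + G (s + z * s') (t + z * t') (u + z * u')" for s s' t t' u u'
  proof -
    obtain p where p: "\<And>z. poly p z = F (s + z * s') (t + z * t') (u + z * u')"
      using ternary_polynomial_line[OF assms(1), of s s' t t' u u'] by auto
    obtain q where "\<And>z. poly q z = G (s + z * s') (t + z * t') (u + z * u')"
      using ternary_polynomial_line[OF assms(2), of s s' t t' u u'] by auto
    with p show ?thesis by (intro exI[of _ "p + q"]) simp
  qed
  with assms show ?thesis
    by (auto simp: ternary_polynomial_def case_prod_unfold intro!: continuous_on_add)
qed

lemma ternary_polynomial_mult:
  assumes "ternary_polynomial F" "ternary_polynomial G"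
  shows "ternary_polynomial (\<lambda>s t u. F s t u * G s t u)"
proof -
  have "\<exists>p. \<forall>z. poly p z =
      F (s + z * s') (t + z * t') (u + z * u') * G (s + z * s') (t + z * t') (u + z * u')" for s s' t t' u u'
  proof -
    obtain p where p: "\<And>z. poly p z = F (s + z * s') (t + z * t') (u + z * u')"
      using ternary_polynomial_line[OF assms(1), of s s' t t' u u'] by auto
    obtain q where "\<And>z. poly q z = G (s + z * s') (t + z * t') (u + z * u')"
      using ternary_polynomial_line[OF assms(2), of s s' t t' u u'] by auto
    with p show ?thesis by (intro exI[of _ "p * q"]) simp
  qed
  with assms show ?thesis
    by (auto simp: ternary_polynomial_def case_prod_unfold intro!: continuous_on_mult)
qed

lemma ternary_form_line:
  "ternary_form N G \<Longrightarrow> \<exists>p. \<forall>z. poly p z = G (s + z * s') (t + z * t') (u + z * u')"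
  unfolding ternary_form_def by (simp add: ternary_polynomial_line)

lemma ternary_form_scale:
  "ternary_form N G \<Longrightarrow> G (c * s) (c * t) (c * u) = c ^ N * G s t u"
  unfolding ternary_form_def by blast

lemma ternary_form_continuous_on:
  assumes "ternary_form N G" "continuous_on S f" "continuous_on S g" "continuous_on S h"
  shows "continuous_on S (\<lambda>x. G (f x) (g x) (h x))"
proof -
  have "continuous_on S ((\<lambda>(s, t, u). G s t u) \<circ> (\<lambda>x. (f x, g x, h x)))"
    using assms by (intro continuous_on_compose continuous_on_Pair)
      (auto simp: ternary_form_def ternary_polynomial_def elim: continuous_on_subset)
  thus ?thesis by (simp add: o_def)
qed

text \<open>
  By homogeneity, running along the line from infinity inwards gives the reversed polynomial, whose
  value at \<open>0\<close> is the value of \<open>G\<close> in the direction of the line.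
\<close>

lemma ternary_form_line_degree:
  assumes G: "ternary_form N G" and nz: "G s' t' u' \<noteq> 0"
    and p: "\<And>z. poly p z = G (s + z * s') (t + z * t') (u + z * u')"
  shows "degree p = N" "lead_coeff p = G s' t' u'"
proof -
  obtain r where r: "\<And>w. poly r w = G (s' + w * s) (t' + w * t) (u' + w * u)"
    using ternary_form_line[OF G, of s' s t' t u' u] by auto
  have "poly p z = z ^ N * poly r (inverse z)" if "z \<noteq> 0" for z
    unfolding p r ternary_form_scale[OF G, symmetric] using that
    by (simp add: algebra_simps)
  moreover have "poly r 0 = G s' t' u'" by (simp add: r)
  ultimately show "degree p = N" "lead_coeff p = G s' t' u'"
    using poly_reversal_degree[of p N r] nz by auto
qed

lemma ternary_form_lower_bound:
  assumes G: "ternary_form N G" and "d \<ge> 0"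
    and roots: "\<And>w. G (s + w * s') (t + w * t') (u + w * u') = 0 \<Longrightarrow> d \<le> cmod (z - w)"
  shows "cmod (G s' t' u') * d ^ N \<le> cmod (G (s + z * s') (t + z * t') (u + z * u'))"
proof (cases "G s' t' u' = 0")
  case False
  obtain p where p: "\<And>z. poly p z = G (s + z * s') (t + z * t') (u + z * u')"
    using ternary_form_line[OF G, of s s' t t' u u'] by auto
  show ?thesis
    using norm_poly_ge_root_distance[of d p z] ternary_form_line_degree[OF G False p] roots
      \<open>d \<ge> 0\<close> by (simp add: p)
qed simp

lemma ternary_polynomial_scale:
  assumes "ternary_polynomial G"
  shows "ternary_polynomial (\<lambda>s t u. G (c * s) (c * t) (c * u))"
proof -
  have "continuous_on UNIV ((\<lambda>(s, t, u). G s t u) \<circ> (\<lambda>x. (c * fst x, c * fst (snd x), c * snd (snd x))))"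
    using assms by (intro continuous_on_compose continuous_intros)
      (auto simp: ternary_polynomial_def elim: continuous_on_subset)
  moreover have "\<exists>p. \<forall>z. poly p z = G (c * (s + z * s')) (c * (t + z * t')) (c * (u + z * u'))"
    for s s' t t' u u'
  proof -
    obtain p where "\<And>z. poly p z = G (c * s + z * (c * s')) (c * t + z * (c * t')) (c * u + z * (c * u'))"
      using ternary_polynomial_line[OF assms, of "c * s" "c * s'" "c * t" "c * t'" "c * u" "c * u'"] by auto
    thus ?thesis by (intro exI[of _ p]) (simp add: algebra_simps)
  qed
  ultimately show ?thesis
    by (simp add: ternary_polynomial_def o_def case_prod_unfold)
qed

text \<open>
  The one-variable identity theorem is applied to the three variables in turn, releasing one of them
  from the real to the complex numbers each time.
\<close>

lemma ternary_polynomial_eqI_real: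
  assumes F: "ternary_polynomial F" and G: "ternary_polynomial G"
    and eq: "\<And>s t u::real. F (of_real s) (of_real t) (of_real u) = G (of_real s) (of_real t) (of_real u)"
  shows "F s t u = G s t u"
proof -
  have 1: "F s t u = G s t u"
    if "\<And>x::real. F (s0 + of_real x * s') (t0 + of_real x * t') (u0 + of_real x * u') =
      G (s0 + of_real x * s') (t0 + of_real x * t') (u0 + of_real x * u')"
    and "s0 + z * s' = s" "t0 + z * t' = t" "u0 + z * u' = u" for s s0 s' t t0 t' u u0 u' z
  proof -
    obtain p where p: "\<And>z. poly p z = F (s0 + z * s') (t0 + z * t') (u0 + z * u')"
      using ternary_polynomial_line[OF F, of s0 s' t0 t' u0 u'] by auto
    obtain q where q: "\<And>z. poly q z = G (s0 + z * s') (t0 + z * t') (u0 + z * u')"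
      using ternary_polynomial_line[OF G, of s0 s' t0 t' u0 u'] by auto
    have "p = q" by (rule complex_poly_eqI_real) (simp add: p q that(1))
    thus ?thesis using p[of z] q[of z] that by simp
  qed
  have 2: "F s (of_real b) (of_real c) = G s (of_real b) (of_real c)" for s and b c :: real
    by (rule 1[of 0 1 b 0 c 0 s]) (simp_all add: eq)
  have 3: "F s t (of_real c) = G s t (of_real c)" for s t and c :: real
    by (rule 1[of s 0 0 1 c 0 t]) (simp_all add: 2)
  show ?thesis
    by (rule 1[of s 0 t 0 0 1 u]) (simp_all add: 3)
qed

text \<open>
  Only the restriction to the span of three vectors is ever extended to complex arguments, which avoids
  complexifying the vector space itself.
\<close>

lemma polynomial_function_complexification:
  fixes g :: "'a::euclidean_space \<Rightarrow> real"
  assumes "real_polynomial_function g"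
  shows "\<exists>G. ternary_polynomial G \<and>
    (\<forall>s t u. G (of_real s) (of_real t) (of_real u) = of_real (g (s *\<^sub>R e + t *\<^sub>R a + u *\<^sub>R v)))"
  using assms
proof induction
  case (linear f)
  interpret f: bounded_linear f by fact
  show ?case
    by (rule exI[of _ "\<lambda>s t u. s * of_real (f e) + t * of_real (f a) + u * of_real (f v)"])
      (simp add: ternary_polynomial_linear f.add f.scaleR)
next
  case (const c)
  show ?case
    by (rule exI[of _ "\<lambda>s t u. of_real c"]) (simp add: ternary_polynomial_const)
next
  case (add f g)
  then obtain F G where FG: "ternary_polynomial F" "ternary_polynomial G"
    "\<forall>s t u. F (of_real s) (of_real t) (of_real u) = of_real (f (s *\<^sub>R e + t *\<^sub>R a + u *\<^sub>R v))"
    "\<forall>s t u. G (of_real s) (of_real t) (of_real u) = of_real (g (s *\<^sub>R e + t *\<^sub>R a + u *\<^sub>R v))"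
    by (elim exE conjE)
  show ?case
    by (rule exI[of _ "\<lambda>s t u. F s t u + G s t u"])
      (use FG ternary_polynomial_add[OF FG(1,2)] in simp)
next
  case (mult f g)
  then obtain F G where FG: "ternary_polynomial F" "ternary_polynomial G"
    "\<forall>s t u. F (of_real s) (of_real t) (of_real u) = of_real (f (s *\<^sub>R e + t *\<^sub>R a + u *\<^sub>R v))"
    "\<forall>s t u. G (of_real s) (of_real t) (of_real u) = of_real (g (s *\<^sub>R e + t *\<^sub>R a + u *\<^sub>R v))"
    by (elim exE conjE)
  show ?case
    by (rule exI[of _ "\<lambda>s t u. F s t u * G s t u"])
      (use FG ternary_polynomial_mult[OF FG(1,2)] in simp)
qed

lemma homogeneous_polynomial_complexification:
  fixes g :: "'a::euclidean_space \<Rightarrow> real"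
  assumes "homogeneous_polynomial N g"
  obtains G where "ternary_form N G"
    "\<And>s t u. G (of_real s) (of_real t) (of_real u) = of_real (g (s *\<^sub>R e + t *\<^sub>R a + u *\<^sub>R v))"
proof -
  from assms have "real_polynomial_function g" and hom: "\<And>c x. g (c *\<^sub>R x) = c ^ N * g x"
    by (auto simp: homogeneous_polynomial_def)
  then obtain G where G: "ternary_polynomial G"
    and real: "\<And>s t u. G (of_real s) (of_real t) (of_real u) = of_real (g (s *\<^sub>R e + t *\<^sub>R a + u *\<^sub>R v))"
    using polynomial_function_complexification[of g e a v] by blast
  have hom_real: "G (of_real c * s) (of_real c * t) (of_real c * u) = of_real c ^ N * G s t u"
    for c :: real and s t u
  proof (rule ternary_polynomial_eqI_real[OF ternary_polynomial_scale[OF G, of "of_real c"]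
        ternary_polynomial_mult[OF ternary_polynomial_const[of "of_real c ^ N"] G]])
    fix s t u :: real
    show "G (of_real c * of_real s) (of_real c * of_real t) (of_real c * of_real u) =
      of_real c ^ N * G (of_real s) (of_real t) (of_real u)"
      using real[of "c * s" "c * t" "c * u"] hom[of c "s *\<^sub>R e + t *\<^sub>R a + u *\<^sub>R v"]
      by (simp add: real scaleR_add_right)
  qed
  have "G (c * s) (c * t) (c * u) = c ^ N * G s t u" for c s t u
  proof -
    obtain p where p: "\<And>z. poly p z = G (0 + z * s) (0 + z * t) (0 + z * u)"
      using ternary_polynomial_line[OF G, of 0 s 0 t 0 u] by auto
    have "p = monom (G s t u) N"
      by (rule complex_poly_eqI_real) (simp add: p hom_real poly_monom)
    with p[of c] show ?thesis by (simp add: poly_monom mult.commute)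
  qed
  with G real show ?thesis
    by (intro that[of G]) (auto simp: ternary_form_def)
qed

section \<open>Hyperbolic directions\<close>

text \<open>
  This is the real-rootedness of \<open>t \<mapsto> g(te + v)\<close> for all \<open>v\<close>. It is phrased for an arbitrary complex
  polynomial that interpolates this function on the real axis; such a polynomial is unique.
\<close>

definition hyperbolic_in :: "('a::euclidean_space \<Rightarrow> real) \<Rightarrow> 'a \<Rightarrow> bool" where
  "hyperbolic_in g e \<longleftrightarrow>
     (\<forall>v p. (\<forall>t. poly p (complex_of_real t) = of_real (g (t *\<^sub>R e + v))) \<longrightarrow>
        (\<forall>z. poly p z = 0 \<longrightarrow> z \<in> \<real>))"

lemma hyperbolic_in_complexification:
  assumes hyp: "hyperbolic_in g e" and G: "ternary_form N G"
    and real: "\<And>s t u. G (of_real s) (of_real t) (of_real u) = of_real (g (s *\<^sub>R e + t *\<^sub>R a + u *\<^sub>R v))"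
    and zero: "G s (of_real b) (of_real c) = 0"
  shows "s \<in> \<real>"
proof -
  obtain p where p: "\<And>z. poly p z = G (0 + z * 1) (of_real b + z * 0) (of_real c + z * 0)"
    using ternary_form_line[OF G, of 0 1 "of_real b" 0 "of_real c" 0] by auto
  have "poly p (of_real t) = of_real (g (t *\<^sub>R e + (b *\<^sub>R a + c *\<^sub>R v)))" for t
    using real[of t b c] by (simp add: p add.assoc)
  moreover have "poly p s = 0" using zero by (simp add: p)
  ultimately show ?thesis using hyp unfolding hyperbolic_in_def by blast
qed

lemma garding_polynomial_imp_hyperbolic:
  fixes g :: "'a::euclidean_space \<Rightarrow> real"
  assumes "garding_polynomial N g \<Gamma>"
  obtains e where "e \<in> \<Gamma>" "hyperbolic_in g e"
proof -
  from assms obtain e where hom: "homogeneous_polynomial N g" and "\<Gamma> \<in> components {x. g x > 0}"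
    and e: "e \<in> \<Gamma>" and roots: "\<And>v. \<exists>p :: real poly.
        p \<noteq> 0 \<and> (\<forall>t. poly p t = g (t *\<^sub>R e + v)) \<and>
        (\<Sum>t\<in>{t. poly p t = 0}. order t p) = N"
    unfolding garding_polynomial_def by auto
  then have ge: "g e > 0" using in_components_subset by blast
  have "z \<in> \<real>"
    if P: "\<And>t. poly P (complex_of_real t) = of_real (g (t *\<^sub>R e + v))" and z: "poly P z = 0" for v P z
  proof -
    obtain p :: "real poly" where p: "p \<noteq> 0" "\<And>t. poly p t = g (t *\<^sub>R e + v)"
      "(\<Sum>t\<in>{t. poly p t = 0}. order t p) = N"
      using roots[of v] by blast
    obtain G where G: "ternary_form N G" and
      real: "\<And>s t u. G (of_real s) (of_real t) (of_real u) = of_real (g (s *\<^sub>R e + t *\<^sub>R v + u *\<^sub>R 0))"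
      using homogeneous_polynomial_complexification[OF hom, of e v 0] by blast
    obtain q where q: "\<And>z. poly q z = G (0 + z * 1) (1 + z * 0) (0 + z * 0)"
      using ternary_form_line[OF G, of 0 1 1 0 0 0] by auto
    \<comment> \<open>Homogeneity and \<open>g(e) > 0\<close> give \<open>t \<mapsto> g(te + v)\<close> the exact degree \<open>N\<close>, so that the \<open>N\<close> real roots are
    all its complex roots.\<close>
    have "G 1 0 0 \<noteq> 0" using real[of 1 0 0] ge by simp
    then have "degree q = N" by (rule ternary_form_line_degree[OF G _ q])
    have qP: "q = P"
      by (rule complex_poly_eqI_real) (use real[of _ 1 0] in \<open>simp add: P q\<close>)
    have Pp: "P = map_poly of_real p"
      by (rule complex_poly_eqI_real) (simp add: P p poly_map_poly_of_real)
    have "degree p = N"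
      using \<open>degree q = N\<close> by (simp add: qP Pp degree_map_poly)
    moreover have "size (proots p) = N"
      using p by (simp add: size_multiset_overloaded_eq)
    ultimately show ?thesis
      using split_real_poly_roots_real[of p z] z p(1) Pp by simp
  qed
  with e that show ?thesis unfolding hyperbolic_in_def by blast
qed

lemma homogeneous_polynomial_continuous_on:
  assumes "homogeneous_polynomial N g" "continuous_on S f"
  shows "continuous_on S (\<lambda>x. g (f x))"
proof -
  have "continuous_on (f ` S) g"
    using assms(1) by (auto simp: homogeneous_polynomial_def
        intro!: differentiable_imp_continuous_on differentiable_on_real_polynomial_function)
  thus ?thesis using assms(2) by (rule continuous_on_compose2) auto
qed

text \<open>
  All roots of \<open>t \<mapsto> g(te + x)\<close> are real and negative here, so that each of the \<open>N\<close> linear factors is at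
  least \<open>t\<close>. Unlike strict positivity, the resulting inequality is a closed condition on \<open>x\<close>.
\<close>

lemma hyperbolic_lower_bound:
  fixes g :: "'a::euclidean_space \<Rightarrow> real"
  assumes hom: "homogeneous_polynomial N g" and hyp: "hyperbolic_in g e" and "g e > 0"
    and pos: "\<And>t. t \<ge> 0 \<Longrightarrow> g (t *\<^sub>R e + x) > 0" and "t \<ge> 0"
  shows "g e * t ^ N \<le> g (t *\<^sub>R e + x)"
proof -
  obtain G where G: "ternary_form N G" and
    real: "\<And>s t u. G (of_real s) (of_real t) (of_real u) = of_real (g (s *\<^sub>R e + t *\<^sub>R x + u *\<^sub>R 0))"
    using homogeneous_polynomial_complexification[OF hom, of e x 0] by blast
  have "t \<le> cmod (of_real t - w)" if w: "G (0 + w * 1) (1 + w * 0) (0 + w * 0) = 0" for w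
  proof -
    have "w \<in> \<real>"
      by (rule hyperbolic_in_complexification[OF hyp G real, of w 1 0]) (use w in simp)
    then obtain r where r: "w = of_real r" by (auto elim: Reals_cases)
    have "g (r *\<^sub>R e + x) = 0" using w real[of r 1 0] by (simp add: r)
    hence "r < 0" using pos[of r] by force
    hence "t \<le> \<bar>t - r\<bar>" by linarith
    also have "\<dots> = cmod (of_real t - w)"
      unfolding r of_real_diff[symmetric] norm_of_real ..
    finally show ?thesis .
  qed
  from ternary_form_lower_bound[OF G \<open>t \<ge> 0\<close>, of 0 1 1 0 0 0, OF this]
  have "cmod (G 1 0 0) * t ^ N \<le> cmod (G (of_real t) 1 0)" by simp
  thus ?thesis
    using real[of 1 0 0] real[of t 1 0] \<open>g e > 0\<close> pos[OF \<open>t \<ge> 0\<close>] by simp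
qed

text \<open>
  The points \<open>x\<close> of the cone for which the whole ray \<open>te + x\<close> stays in \<open>{g > 0}\<close> form an open subset
  of the cone, because the ray can be rescaled to the compact segment from \<open>e\<close> to \<open>x\<close>, and a closed
  subset, because positivity on the ray is equivalent to the quantitative bound of
  \<open>hyperbolic_lower_bound\<close>. The cone is connected.
\<close>

lemma garding_cone_starlike:
  fixes g :: "'a::euclidean_space \<Rightarrow> real"
  assumes hom: "homogeneous_polynomial N g" and \<Gamma>: "\<Gamma> \<in> components {x. g x > 0}"
    and hyp: "hyperbolic_in g e" and e: "e \<in> \<Gamma>" and "x \<in> \<Gamma>" and "t \<ge> 0"
  shows "g (t *\<^sub>R e + x) > 0"
proof -
  have scale: "g (c *\<^sub>R y) = c ^ N * g y" for c y
    using hom by (simp add: homogeneous_polynomial_def)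
  have pos: "g y > 0" if "y \<in> \<Gamma>" for y
    using \<Gamma> that in_components_subset by blast
  define A where "A = {y \<in> \<Gamma>. \<forall>t\<ge>0. g (t *\<^sub>R e + y) > 0}"
  \<comment> \<open>The complement of \<open>B\<close> consists of the points \<open>y\<close> whose segment to \<open>e\<close> lies in \<open>{g > 0}\<close>.\<close>
  define B where "B = {y. \<exists>b\<in>{0..1::real}. g ((1 - b) *\<^sub>R e + b *\<^sub>R y) \<le> 0}"
  have "closed {z :: real \<times> 'a. g ((1 - fst z) *\<^sub>R e + fst z *\<^sub>R snd z) \<le> 0}"
    by (intro closed_Collect_le homogeneous_polynomial_continuous_on[OF hom] continuous_intros)
  from closed_compact_projection[OF compact_Icc this, of 0 1] have "closed B"
    by (simp add: B_def Bex_def)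
  have AB: "A = \<Gamma> \<inter> - B"
  proof -
    have "y \<notin> B" if "y \<in> A" for y
    proof
      assume "y \<in> B"
      then obtain b where b: "0 \<le> b" "b \<le> 1" "g ((1 - b) *\<^sub>R e + b *\<^sub>R y) \<le> 0"
        by (auto simp: B_def)
      show False
      proof (cases "b = 0")
        case True
        with b pos[OF e] show False by simp
      next
        case False
        have "(1 - b) *\<^sub>R e + b *\<^sub>R y = b *\<^sub>R (((1 - b) / b) *\<^sub>R e + y)"
          using False by (simp add: scaleR_add_right)
        moreover have "g (((1 - b) / b) *\<^sub>R e + y) > 0"
          using that b False by (auto simp: A_def)
        ultimately show False using b False scale
          by (metis linorder_not_le mult_pos_pos order_le_imp_less_or_eq zero_less_power)
      qed
    qed
    moreover have "y \<in> A" if y: "y \<in> \<Gamma>" "y \<notin> B" for y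
      unfolding A_def
    proof (intro CollectI conjI allI impI)
      fix t :: real assume t: "t \<ge> 0"
      define b where "b = 1 / (1 + t)"
      have b: "b \<in> {0..1}" "b > 0" "(1 + t) * b = 1" "(1 + t) * (1 - b) = t"
        using t by (auto simp: b_def field_simps)
      have "t *\<^sub>R e + y = (1 + t) *\<^sub>R ((1 - b) *\<^sub>R e + b *\<^sub>R y)"
        unfolding scaleR_add_right scaleR_scaleR b by simp
      moreover have "g ((1 - b) *\<^sub>R e + b *\<^sub>R y) > 0"
        using y b by (auto simp: B_def not_le)
      ultimately show "g (t *\<^sub>R e + y) > 0" using t by (simp add: scale)
    qed (fact y)
    ultimately show ?thesis by (auto simp: A_def)
  qed
  have AC: "A = \<Gamma> \<inter> (\<Inter>t\<in>{0..}. {y. g e * t ^ N \<le> g (t *\<^sub>R e + y)})"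
  proof -
    have "g e * t ^ N \<le> g (t *\<^sub>R e + y)" if "y \<in> A" "t \<ge> 0" for y t
      using that by (intro hyperbolic_lower_bound[OF hom hyp pos[OF e]]) (auto simp: A_def)
    moreover have "g (t *\<^sub>R e + y) > 0"
      if y: "y \<in> \<Gamma>" and bound: "\<And>t. t \<ge> 0 \<Longrightarrow> g e * t ^ N \<le> g (t *\<^sub>R e + y)" and "t \<ge> 0" for y t
    proof (cases "t = 0")
      case True
      with pos[OF y] show ?thesis by simp
    next
      case False
      with \<open>t \<ge> 0\<close> pos[OF e] have "0 < g e * t ^ N" by simp
      with bound[OF \<open>t \<ge> 0\<close>] show ?thesis by linarith
    qed
    ultimately show ?thesis by (auto simp: A_def)
  qed
  have "openin (top_of_set \<Gamma>) A"
    unfolding AB by (intro openin_open_Int open_Compl \<open>closed B\<close>)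
  moreover have "closedin (top_of_set \<Gamma>) A"
    unfolding AC by (intro closedin_closed_Int closed_INT ballI closed_Collect_le
        homogeneous_polynomial_continuous_on[OF hom] continuous_intros)
  moreover have "connected \<Gamma>" using \<Gamma> in_components_connected by blast
  moreover have "e \<in> A"
  proof -
    have "g (t *\<^sub>R e + e) > 0" if "t \<ge> 0" for t
    proof -
      have "t *\<^sub>R e + e = (1 + t) *\<^sub>R e" by (simp add: algebra_simps)
      thus ?thesis using scale[of "1 + t" e] pos[OF e] that by simp
    qed
    with e show ?thesis by (simp add: A_def)
  qed
  ultimately have "A = \<Gamma>" unfolding connected_clopen by blast
  with \<open>x \<in> \<Gamma>\<close> \<open>t \<ge> 0\<close> show ?thesis by (auto simp: A_def)
qed

section \<open>All directions of the cone are hyperbolic\<close>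

text \<open>
  This is the core of the argument. Write \<open>P\<^sub>u(t) = G(\<i>, t, u)\<close>, a polynomial of degree \<open>N\<close> in \<open>t\<close> with
  leading coefficient \<open>g(a)\<close> independent of \<open>u\<close>. It has no real root, as a real root \<open>t\<close> would make \<open>\<i>\<close> a root
  of the real-rooted polynomial \<open>s \<mapsto> g(se + ta + uv)\<close>. Hence no root can cross the real axis as \<open>u\<close>
  varies over the real line, and at \<open>u = 0\<close> all roots lie in the lower half-plane, as they are
  \<open>\<i>/r\<close> with \<open>r\<close> a negative root of \<open>r \<mapsto> g(re + a)\<close>.

  The crossing argument is made precise by showing that the set \<open>A\<close> of good parameters \<open>u\<close>, those for which all
  roots lie in the lower half-plane, is closed and open. It is closed by
  \<open>ternary_form_lower_bound\<close>. It is open because, after the closed upper half-plane together with infinity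
  has been mapped to the closed unit disc, the bad parameters are the projection of a closed set along a
  compact one.
\<close>

lemma garding_cone_nonvanishing:
  fixes g :: "'a::euclidean_space \<Rightarrow> real"
  assumes hom: "homogeneous_polynomial N g" and \<Gamma>: "\<Gamma> \<in> components {x. g x > 0}"
    and hyp: "hyperbolic_in g e" and e: "e \<in> \<Gamma>" and a: "a \<in> \<Gamma>"
    and G: "ternary_form N G"
    and real: "\<And>s t u. G (of_real s) (of_real t) (of_real u) = of_real (g (s *\<^sub>R e + t *\<^sub>R a + u *\<^sub>R v))"
    and t: "Im t \<ge> 0"
  shows "G \<i> t (of_real u) \<noteq> 0"
proof -
  have ge: "g e > 0" and ga: "g a > 0"
    using \<Gamma> e a in_components_subset by blast+
  have G100: "G 1 0 0 = of_real (g e)" and G010: "G 0 1 0 = of_real (g a)"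
    using real[of 1 0 0] real[of 0 1 0] by simp_all
  note scale = ternary_form_scale[OF G]
  note cont = ternary_form_continuous_on[OF G]
  define A where "A = {u::real. \<forall>t. Im t \<ge> 0 \<longrightarrow> G \<i> t (of_real u) \<noteq> 0}"
  have "A = (\<Inter>t\<in>{t. Im t \<ge> 0}. {u. cmod (G 0 1 0) * Im t ^ N \<le> cmod (G \<i> t (of_real u))})"
  proof -
    have "cmod (G 0 1 0) * Im t ^ N \<le> cmod (G \<i> t (of_real u))" if "u \<in> A" "Im t \<ge> 0" for u t
    proof -
      have "Im t \<le> cmod (t - w)" if w: "G (\<i> + w * 0) (0 + w * 1) (of_real u + w * 0) = 0" for w
      proof -
        have "Im w < 0" using w \<open>u \<in> A\<close> by (auto simp: A_def not_le[symmetric])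
        hence "Im t \<le> \<bar>Im (t - w)\<bar>" by simp
        also have "\<dots> \<le> cmod (t - w)" by (rule abs_Im_le_cmod)
        finally show ?thesis .
      qed
      from ternary_form_lower_bound[OF G \<open>Im t \<ge> 0\<close>, of \<i> 0 0 1 "of_real u" 0, OF this]
      show ?thesis by simp
    qed
    moreover have "G \<i> t (of_real u) \<noteq> 0"
      if bound: "cmod (G 0 1 0) * Im t ^ N \<le> cmod (G \<i> t (of_real u))" and "Im t \<ge> 0" for u t
    proof
      assume zero: "G \<i> t (of_real u) = 0"
      show False
      proof (cases "Im t = 0")
        case True
        hence "t = of_real (Re t)" by (simp add: complex_eq_iff)
        with zero have "\<i> \<in> \<real>"
          by (intro hyperbolic_in_complexification[OF hyp G real, of \<i> "Re t" u]) simp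
        thus False by (simp add: complex_is_Real_iff)
      next
        case False
        with \<open>Im t \<ge> 0\<close> ga have "0 < cmod (G 0 1 0) * Im t ^ N" by (simp add: G010)
        with bound zero show False by simp
      qed
    qed
    ultimately show ?thesis by (auto simp: A_def)
  qed
  moreover have "closed \<dots>"
    by (intro closed_INT ballI closed_Collect_le continuous_intros cont)
  ultimately have "closed A" by simp
  \<comment> \<open>The Cayley transform \<open>t = \<i>(1 + w)/(1 - w)\<close>, with denominators cleared by homogeneity. The
  additional point \<open>w = 1\<close> stands for \<open>t = \<infinity>\<close>, where the value is a multiple of \<open>g(a) \<noteq> 0\<close>.\<close>
  have "- A = {u. \<exists>w. w \<in> cball 0 1 \<and>
      (w, u) \<in> {p. G (\<i> * (1 - fst p)) (\<i> * (1 + fst p)) (of_real (snd p) * (1 - fst p)) = 0}}"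
  proof -
    have "\<exists>w. cmod w \<le> 1 \<and> G (\<i> * (1 - w)) (\<i> * (1 + w)) (of_real u * (1 - w)) = 0"
      if "Im t \<ge> 0" "G \<i> t (of_real u) = 0" for t u
    proof -
      have nz: "t + \<i> \<noteq> 0" using that(1) by (auto simp: complex_eq_iff)
      define w where "w = (t - \<i>) / (t + \<i>)"
      \<comment> \<open>Scaling \<open>(\<i>, t, u)\<close> by \<open>k\<close> gives the point in the Cayley coordinate \<open>w\<close>.\<close>
      define k where "k = 2 * \<i> / (t + \<i>)"
      have k: "1 - w = k" "\<i> * (1 + w) = k * t"
        using nz by (auto simp: w_def k_def field_simps)
      have "cmod (t - \<i>) \<le> cmod (t + \<i>)"
        unfolding cmod_def using that(1) by (simp add: power2_eq_square algebra_simps)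
      hence "cmod w \<le> 1"
        using nz by (simp add: w_def norm_divide divide_le_eq_1)
      moreover have "G (\<i> * (1 - w)) (\<i> * (1 + w)) (of_real u * (1 - w)) = 0"
        unfolding k using scale[of k \<i> t "of_real u"] that(2) by (simp add: mult.commute)
      ultimately show ?thesis by blast
    qed
    moreover have "\<exists>t. Im t \<ge> 0 \<and> G \<i> t (of_real u) = 0"
      if w: "cmod w \<le> 1" and zero: "G (\<i> * (1 - w)) (\<i> * (1 + w)) (of_real u * (1 - w)) = 0" for w u
    proof -
      have "w \<noteq> 1"
      proof
        assume "w = 1"
        with zero have "G ((2 * \<i>) * 0) ((2 * \<i>) * 1) ((2 * \<i>) * 0) = 0" by (simp add: mult.commute)
        with ga show False unfolding scale G010 by simp
      qed
      define t where "t = \<i> * ((1 + w) / (1 - w))"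
      have "(Re w)\<^sup>2 + (Im w)\<^sup>2 \<le> 1"
        using w by (simp add: cmod_power2[symmetric] power_le_one)
      hence "(1 + Re w) * (1 - Re w) + Im w * (- Im w) \<ge> 0"
        by (simp add: power2_eq_square algebra_simps)
      hence "Im t \<ge> 0" unfolding t_def Im_i_times by (simp add: Re_divide)
      moreover have "(1 - w) ^ N * G \<i> t (of_real u) = 0"
        using zero \<open>w \<noteq> 1\<close> unfolding scale[symmetric]
        by (simp add: t_def mult_ac)
      with \<open>w \<noteq> 1\<close> have "G \<i> t (of_real u) = 0" by simp
      ultimately show ?thesis by blast
    qed
    ultimately have "(\<exists>t. Im t \<ge> 0 \<and> G \<i> t (of_real u) = 0) \<longleftrightarrow>
        (\<exists>w. cmod w \<le> 1 \<and> G (\<i> * (1 - w)) (\<i> * (1 + w)) (of_real u * (1 - w)) = 0)" for u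
      by (intro iffI; elim exE conjE)
    thus ?thesis by (simp add: A_def set_eq_iff)
  qed
  moreover have "closed \<dots>"
    by (intro closed_compact_projection compact_cball closed_Collect_eq continuous_intros cont)
  ultimately have "open A" using open_closed by (metis)
  have "0 \<in> A"
  proof -
    have False if t: "Im t \<ge> 0" and zero: "G \<i> t 0 = 0" for t
    proof -
      have "t \<noteq> 0"
        using zero scale[of \<i> 1 0 0] G100 ge by auto
      with zero have "G (\<i> / t) (of_real 1) (of_real 0) = 0"
        using scale[of t "\<i> / t" 1 0] by simp
      moreover from this have "\<i> / t \<in> \<real>"
        by (rule hyperbolic_in_complexification[OF hyp G real])
      then obtain r where r: "\<i> / t = of_real r" by (auto elim: Reals_cases)
      ultimately have "g (r *\<^sub>R e + a) = 0"
        using real[of r 1 0] by simp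
      hence "r < 0"
        using garding_cone_starlike[OF hom \<Gamma> hyp e a, of r] by force
      have "\<i> = of_real r * t" using r \<open>t \<noteq> 0\<close> by (simp add: field_simps)
      from arg_cong[OF this, of Im] have "1 = r * Im t" by simp
      with \<open>r < 0\<close> t show False
        by (smt (verit) mult_nonneg_nonpos mult.commute)
    qed
    thus ?thesis by (auto simp: A_def)
  qed
  with \<open>open A\<close> \<open>closed A\<close> have "A = UNIV" using clopen[of A] by blast
  with t show ?thesis by (auto simp: A_def)
qed

text \<open>
  By scaling, \<open>garding_cone_nonvanishing\<close> says that \<open>t \<mapsto> G(d\<i>, t, u)\<close> has all its roots in the
  lower half-plane for every \<open>d > 0\<close>. As \<open>d\<close> tends to \<open>0\<close>, the roots of \<open>t \<mapsto> g(ta + uv)\<close> have imaginary part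
  at most \<open>0\<close>. Applying this with \<open>u = 1\<close> and \<open>u = -1\<close> makes them real.
\<close>

lemma garding_cone_hyperbolic:
  fixes g :: "'a::euclidean_space \<Rightarrow> real"
  assumes hom: "homogeneous_polynomial N g" and \<Gamma>: "\<Gamma> \<in> components {x. g x > 0}"
    and hyp: "hyperbolic_in g e" and e: "e \<in> \<Gamma>" and a: "a \<in> \<Gamma>"
  shows "hyperbolic_in g a"
  unfolding hyperbolic_in_def
proof (intro allI impI)
  fix v p z
  assume p: "\<forall>t. poly p (complex_of_real t) = of_real (g (t *\<^sub>R a + v))" and z: "poly p z = 0"
  have ga: "g a > 0"
    using \<Gamma> a in_components_subset by blast
  obtain G where G: "ternary_form N G" and
    real: "\<And>s t u. G (of_real s) (of_real t) (of_real u) = of_real (g (s *\<^sub>R e + t *\<^sub>R a + u *\<^sub>R v))"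
    using homogeneous_polynomial_complexification[OF hom, of e a v] by blast
  have G010: "G 0 1 0 = of_real (g a)"
    using real[of 0 1 0] by simp
  have shifted: "G (of_real d * \<i>) t (of_real u) \<noteq> 0" if "d > 0" "Im t \<ge> 0" for d u t
  proof -
    have "G \<i> (t / of_real d) (of_real (u / d)) \<noteq> 0"
      using that by (intro garding_cone_nonvanishing[OF hom \<Gamma> hyp e a G real]) simp
    thus ?thesis
      using ternary_form_scale[OF G, of "of_real d" \<i> "t / of_real d" "of_real (u / d)"] that by simp
  qed
  have nonzero: "G 0 t (of_real u) \<noteq> 0" if "Im t > 0" for t u
  proof -
    have bound: "cmod (G 0 1 0) * Im t ^ N \<le> cmod (G (of_real d * \<i>) t (of_real u))" if "d > 0" for d
    proof -
      have "Im t \<le> cmod (t - w)" if w: "G (of_real d * \<i> + w * 0) (0 + w * 1) (of_real u + w * 0) = 0" for w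
      proof -
        have "Im w < 0" using w shifted[OF \<open>d > 0\<close>, of w u] by (auto simp: not_le[symmetric])
        hence "Im t \<le> \<bar>Im (t - w)\<bar>" by simp
        also have "\<dots> \<le> cmod (t - w)" by (rule abs_Im_le_cmod)
        finally show ?thesis .
      qed
      from ternary_form_lower_bound[OF G, of "Im t" "of_real d * \<i>" 0 0 1 "of_real u" 0 t, OF _ this] \<open>Im t > 0\<close>
      show ?thesis
        by simp
    qed
    have "continuous_on UNIV (\<lambda>d::real. cmod (G (of_real d * \<i>) t (of_real u)))"
      by (intro continuous_intros ternary_form_continuous_on[OF G])
    hence "((\<lambda>d. cmod (G (of_real d * \<i>) t (of_real u))) \<longlongrightarrow> cmod (G (of_real 0 * \<i>) t (of_real u))) (at_right 0)"
      unfolding continuous_on_def by (blast intro: tendsto_within_subset)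
    hence "cmod (G 0 1 0) * Im t ^ N \<le> cmod (G (of_real 0 * \<i>) t (of_real u))"
      by (rule tendsto_lowerbound)
        (auto simp: eventually_at_right_less intro: eventually_mono[OF eventually_at_right_less] bound)
    moreover have "0 < cmod (G 0 1 0) * Im t ^ N" using ga \<open>Im t > 0\<close> by (simp add: G010)
    ultimately show ?thesis by auto
  qed
  obtain q where q: "\<And>z. poly q z = G (0 + z * 0) (0 + z * 1) (1 + z * 0)"
    using ternary_form_line[OF G, of 0 0 0 1 1 0] by auto
  have "q = p"
    by (rule complex_poly_eqI_real) (use real[of 0 _ 1] in \<open>simp add: p q\<close>)
  hence "G 0 z 1 = 0" using q[of z] z by simp
  hence "G 0 (-z) (-1) = 0"
    using ternary_form_scale[OF G, of "-1" 0 z 1] by simp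
  have "\<not> Im z > 0" using nonzero[of z 1] \<open>G 0 z 1 = 0\<close> by auto
  moreover have "\<not> Im (-z) > 0" using nonzero[of "-z" "-1"] \<open>G 0 (-z) (-1) = 0\<close> by auto
  ultimately show "z \<in> \<real>" by (simp add: complex_is_Real_iff)
qed

section \<open>The logarithmic differential\<close>

text \<open>
  For two points of the cone, \<open>t \<mapsto> g(tx + x')\<close> has only real roots by \<open>garding_cone_hyperbolic\<close>, and no
  root at or above \<open>0\<close> by \<open>garding_cone_starlike\<close> with \<open>x\<close> as the base point. The numbers in \<open>M\<close> are the
  negatives of the roots.
\<close>

lemma garding_cone_factorization:
  fixes g :: "'a::euclidean_space \<Rightarrow> real"
  assumes hom: "homogeneous_polynomial N g" and \<Gamma>: "\<Gamma> \<in> components {x. g x > 0}"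
    and hyp: "hyperbolic_in g e" and e: "e \<in> \<Gamma>" and x: "x \<in> \<Gamma>" and x': "x' \<in> \<Gamma>"
  obtains M :: "real multiset" where "size M = N" "\<And>l. l \<in># M \<Longrightarrow> l > 0"
    "\<And>s t. g (t *\<^sub>R x + s *\<^sub>R x') = g x * (\<Prod>l\<in>#M. t + s * l)"
proof -
  have hypx: "hyperbolic_in g x"
    by (rule garding_cone_hyperbolic[OF hom \<Gamma> hyp e x])
  have gx: "g x > 0"
    using \<Gamma> x in_components_subset by blast
  have scale: "g (c *\<^sub>R y) = c ^ N * g y" for c y
    using hom by (simp add: homogeneous_polynomial_def)
  obtain G where G: "ternary_form N G" and
    real: "\<And>s t u. G (of_real s) (of_real t) (of_real u) = of_real (g (s *\<^sub>R x + t *\<^sub>R x' + u *\<^sub>R 0))"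
    using homogeneous_polynomial_complexification[OF hom, of x x' 0] by blast
  obtain p where p: "\<And>z. poly p z = G (0 + z * 1) (1 + z * 0) (0 + z * 0)"
    using ternary_form_line[OF G, of 0 1 1 0 0 0] by auto
  have G100: "G 1 0 0 = of_real (g x)" using real[of 1 0 0] by simp
  have deg: "degree p = N" and lead: "lead_coeff p = of_real (g x)"
    using ternary_form_line_degree[OF G _ p] G100 gx by simp_all
  then have "p \<noteq> 0" using gx by auto
  have root: "z = of_real (Re z)" "Re z < 0" if "z \<in># proots p" for z
  proof -
    have z: "G z (of_real 1) (of_real 0) = 0"
      using that \<open>p \<noteq> 0\<close> p[of z] by simp
    hence "z \<in> \<real>"
      by (rule hyperbolic_in_complexification[OF hypx G real])
    thus *: "z = of_real (Re z)" by simp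
    have "g (Re z *\<^sub>R x + x') = 0"
      using z real[of "Re z" 1 0] by (simp add: *[symmetric])
    thus "Re z < 0"
      using garding_cone_starlike[OF hom \<Gamma> hypx x x', of "Re z"] by force
  qed
  define M where "M = image_mset (\<lambda>z. - Re z) (proots p)"
  have size: "size M = N" by (simp add: M_def size_proots_complex deg)
  have fact1: "g (t *\<^sub>R x + x') = g x * (\<Prod>l\<in>#M. t + l)" for t
  proof -
    have "(\<Prod>z\<in>#R. of_real t - z) = complex_of_real (\<Prod>z\<in>#R. t - Re z)"
      if "\<And>z. z \<in># R \<Longrightarrow> z = of_real (Re z)" for R
      using that
    proof (induction R)
      case (add z R)
      from add.prems[of z] have "of_real t - z = complex_of_real (t - Re z)"
        by (metis of_real_diff union_single_eq_member)
      with add show ?case by simp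
    qed simp
    from this[of "proots p"] root(1)
    have *: "(\<Prod>z\<in>#proots p. of_real t - z) = complex_of_real (\<Prod>z\<in>#proots p. t - Re z)"
      by blast
    have "complex_of_real (g (t *\<^sub>R x + x')) = poly p (of_real t)"
      using real[of t 1 0] by (simp add: p)
    also have "\<dots> = poly (smult (lead_coeff p) (\<Prod>z\<in>#proots p. [:-z, 1:])) (of_real t)"
      by (simp only: complex_poly_decompose_multiset)
    also have "\<dots> = of_real (g x) * (\<Prod>z\<in>#proots p. of_real t - z)"
      by (simp add: lead poly_prod_mset image_mset.compositionality o_def)
    also have "\<dots> = of_real (g x * (\<Prod>z\<in>#proots p. t - Re z))"
      by (simp add: *)
    finally have "g (t *\<^sub>R x + x') = g x * (\<Prod>z\<in>#proots p. t - Re z)"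
      by (simp only: of_real_eq_iff)
    thus ?thesis by (simp add: M_def image_mset.compositionality o_def)
  qed
  have "g (t *\<^sub>R x + s *\<^sub>R x') = g x * (\<Prod>l\<in>#M. t + s * l)" for s t
  proof (cases "s = 0")
    case True
    have "(\<Prod>l\<in>#M. t) = t ^ N" by (simp add: size)
    with True show ?thesis by (simp add: scale)
  next
    case False
    have "t *\<^sub>R x + s *\<^sub>R x' = s *\<^sub>R ((t / s) *\<^sub>R x + x')"
      using False by (simp add: scaleR_add_right)
    hence "g (t *\<^sub>R x + s *\<^sub>R x') = g x * (s ^ N * (\<Prod>l\<in>#M. t / s + l))"
      by (simp add: scale fact1)
    also have "s ^ N * (\<Prod>l\<in>#M. t / s + l) = (\<Prod>l\<in>#M. s * (t / s + l))"
      by (simp add: prod_mset.distrib size)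
    also have "\<dots> = (\<Prod>l\<in>#M. t + s * l)"
      using False by (simp add: distrib_left)
    finally show ?thesis .
  qed
  moreover have "l > 0" if "l \<in># M" for l
    using that root(2) by (auto simp: M_def)
  ultimately show ?thesis using that size by blast
qed

text \<open>
  The differential of \<open>log g\<close> is evaluated along a line through \<open>x\<close> on which \<open>g\<close> is a known multiple of
  \<open>g(x)\<close>; necessarily \<open>h(0) = 1\<close>, which is why \<open>d\<close> is also the logarithmic derivative of \<open>h\<close>.
\<close>

lemma log_differential_directional:
  fixes g :: "'a::euclidean_space \<Rightarrow> real"
  assumes "real_polynomial_function g" "g x > 0"
    and h: "\<And>s. g (x + s *\<^sub>R v) = g x * h s" and D: "(h has_real_derivative d) (at 0)"
  shows "blinfun_apply (log_differential g x) v = d"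
proof -
  have "g differentiable at x"
    by (rule differentiable_at_real_polynomial_function) fact
  then obtain g' where "(g has_derivative g') (at x)"
    unfolding differentiable_def by blast
  from has_derivative_ln[OF _ this] \<open>g x > 0\<close>
  have "potential g differentiable at x"
    unfolding differentiable_def potential_def by blast
  hence "(potential g has_derivative frechet_derivative (potential g) (at x)) (at x)"
    by (simp add: frechet_derivative_works)
  moreover from this
  have "frechet_derivative (potential g) (at x) = blinfun_apply (log_differential g x)"
    unfolding log_differential_def by (simp add: bounded_linear_Blinfun_apply has_derivative_bounded_linear)
  ultimately have F: "(potential g has_derivative blinfun_apply (log_differential g x)) (at (x + 0 *\<^sub>R v))"
    by simp
  have "((\<lambda>s. x + s *\<^sub>R v) has_derivative (\<lambda>s. s *\<^sub>R v)) (at 0)"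
    by (auto intro!: derivative_eq_intros)
  from has_derivative_compose[OF this F]
  have 1: "((\<lambda>s. ln (g (x + s *\<^sub>R v))) has_real_derivative blinfun_apply (log_differential g x) v) (at 0)"
    by (simp add: has_field_derivative_def potential_def blinfun.scaleR_right mult_commute_abs)
  have h0: "h 0 = 1" using h[of 0] \<open>g x > 0\<close> by simp
  have "((\<lambda>s. ln (g x * h s)) has_real_derivative d) (at 0)"
    using \<open>g x > 0\<close> h0 by (auto intro!: derivative_eq_intros D)
  with 1 show ?thesis unfolding h by (rule DERIV_unique)
qed

lemma has_derivative_prod_mset_at_0:
  "((\<lambda>s. \<Prod>l\<in>#M. 1 + s * l) has_real_derivative sum_mset M) (at 0)"
proof (induction M)
  case (add l M)
  have "((\<lambda>s. (1 + s * l) * (\<Prod>l\<in>#M. 1 + s * l)) has_real_derivative l + sum_mset M) (at 0)"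
    by (auto intro!: derivative_eq_intros add.IH)
  thus ?case by simp
qed simp

text \<open>
  A form of the arithmetic-geometric mean inequality, from \<open>l \<le> exp (l - 1)\<close>. It is used
  when the arithmetic mean is \<open>1\<close>, where it bounds the product by \<open>1\<close>.
\<close>

lemma prod_mset_le_exp:
  fixes M :: "real multiset"
  assumes "\<And>l. l \<in># M \<Longrightarrow> l \<ge> 0"
  shows "prod_mset M \<le> exp (sum_mset M - size M)"
proof -
  have "0 \<le> prod_mset M \<and> prod_mset M \<le> exp (sum_mset M - size M)"
    using assms
  proof (induction M)
    case (add l M)
    hence IH: "0 \<le> prod_mset M" "prod_mset M \<le> exp (sum_mset M - size M)" and "0 \<le> l"
      by auto
    have "l * prod_mset M \<le> exp (l - 1) * exp (sum_mset M - size M)"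
      using exp_ge_add_one_self[of "l - 1"] IH \<open>0 \<le> l\<close> by (intro mult_mono) auto
    also have "\<dots> = exp (sum_mset (add_mset l M) - size (add_mset l M))"
      by (simp add: exp_add[symmetric] algebra_simps)
    finally show ?case using IH \<open>0 \<le> l\<close> by simp
  qed simp
  thus ?thesis ..
qed

text \<open>
  Euler's identity for the logarithm of a homogeneous function.
\<close>

lemma log_differential_self:
  assumes hom: "homogeneous_polynomial N g" and "g x > 0"
  shows "blinfun_apply (log_differential g x) x = real N"
proof (rule log_differential_directional)
  show "g (x + s *\<^sub>R x) = g x * (1 + s) ^ N" for s
  proof -
    have "x + s *\<^sub>R x = (1 + s) *\<^sub>R x" by (simp add: algebra_simps)
    thus ?thesis using hom by (simp add: homogeneous_polynomial_def)
  qed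
  show "((\<lambda>s. (1 + s) ^ N) has_real_derivative real N) (at 0)"
    by (auto intro!: derivative_eq_intros)
qed (use assms in \<open>auto simp: homogeneous_polynomial_def\<close>)

text \<open>
  This is the tangent inequality for the concave function \<open>log g\<close> on the cone, in the case where the tangent
  term vanishes: with the factors \<open>l\<close> of \<open>garding_cone_factorization\<close>, the pairing is the
  sum of the \<open>l\<close> and \<open>g(x')/g(x)\<close> is their product, so the arithmetic-geometric mean inequality applies.
\<close>

lemma garding_le_if_pairing_eq_degree:
  assumes g: "garding_polynomial N g \<Gamma>" and x: "x \<in> \<Gamma>" and x': "x' \<in> \<Gamma>"
    and pairing: "blinfun_apply (log_differential g x) x' = real N"
  shows "g x' \<le> g x"
proof -
  obtain e where e: "e \<in> \<Gamma>" "hyperbolic_in g e"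
    using garding_polynomial_imp_hyperbolic[OF g] .
  have hom: "homogeneous_polynomial N g" and \<Gamma>: "\<Gamma> \<in> components {x. g x > 0}"
    using g by (auto simp: garding_polynomial_def)
  have gx: "g x > 0" using \<Gamma> x in_components_subset by blast
  obtain M where M: "size M = N" "\<And>l. l \<in># M \<Longrightarrow> l > 0"
    "\<And>s t. g (t *\<^sub>R x + s *\<^sub>R x') = g x * (\<Prod>l\<in>#M. t + s * l)"
    using garding_cone_factorization[OF hom \<Gamma> e(2,1) x x'] by blast
  have "blinfun_apply (log_differential g x) x' = sum_mset M"
  proof (rule log_differential_directional)
    show "real_polynomial_function g" using hom by (simp add: homogeneous_polynomial_def)
    show "g (x + s *\<^sub>R x') = g x * (\<Prod>l\<in>#M. 1 + s * l)" for s
      using M(3)[of 1 s] by simp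
  qed (fact gx has_derivative_prod_mset_at_0)+
  with pairing have "sum_mset M = size M" using M(1) by simp
  with prod_mset_le_exp[of M] M(2) have "prod_mset M \<le> 1" by force
  thus ?thesis using M(3)[of 0 1] gx by simp
qed

theorem proposition10p3:
  fixes g :: "'a::euclidean_space \<Rightarrow> real" and \<Gamma> :: "'a set" and N :: nat
    and x :: 'a and y :: "'a \<Rightarrow>\<^sub>L real"
  assumes "N \<ge> 1"
    and "garding_polynomial N g \<Gamma>"
    and "x \<in> \<Gamma>"
    and "y \<in> open_polar \<Gamma>"
    and "y = log_differential g x"
  shows "g x * dual_garding g \<Gamma> y = 1 \<and>
         potential g x + dual_potential g \<Gamma> y = 0 \<and>
         blinfun_apply y x = real N"
proof -
  note g = \<open>garding_polynomial N g \<Gamma>\<close>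
  have hom: "homogeneous_polynomial N g" and \<Gamma>: "\<Gamma> \<in> components {x. g x > 0}"
    using g by (auto simp: garding_polynomial_def)
  have pos: "g z > 0" if "z \<in> \<Gamma>" for z
    using \<Gamma> that in_components_subset by blast
  have euler: "blinfun_apply (log_differential g z) z = real N" if "z \<in> \<Gamma>" for z
    by (rule log_differential_self[OF hom pos[OF that]])
  \<comment> \<open>Well-definedness of the dual function: two points with the same differential pair to \<open>N\<close>
  crosswise as well, by Euler's identity at each of them.\<close>
  have unique: "g z = g x" if "z \<in> \<Gamma>" "log_differential g z = y" for z
  proof (rule antisym)
    show "g z \<le> g x"
      using garding_le_if_pairing_eq_degree[OF g \<open>x \<in> \<Gamma>\<close> \<open>z \<in> \<Gamma>\<close>] euler[OF \<open>z \<in> \<Gamma>\<close>]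
        that(2) \<open>y = log_differential g x\<close> by simp
    show "g x \<le> g z"
      using garding_le_if_pairing_eq_degree[OF g \<open>z \<in> \<Gamma>\<close> \<open>x \<in> \<Gamma>\<close>] euler[OF \<open>x \<in> \<Gamma>\<close>]
        that(2) \<open>y = log_differential g x\<close> by simp
  qed
  have "dual_garding g \<Gamma> y = 1 / g x"
    unfolding dual_garding_def
  proof (rule the_equality)
    show "\<exists>z\<in>\<Gamma>. log_differential g z = y \<and> 1 / g x = 1 / g z"
      using \<open>x \<in> \<Gamma>\<close> \<open>y = log_differential g x\<close> by blast
  next
    fix c assume "\<exists>z\<in>\<Gamma>. log_differential g z = y \<and> c = 1 / g z"
    then obtain z where "z \<in> \<Gamma>" "log_differential g z = y" "c = 1 / g z" by blast
    with unique[of z] show "c = 1 / g x" by simp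
  qed
  with pos[OF \<open>x \<in> \<Gamma>\<close>] euler[OF \<open>x \<in> \<Gamma>\<close>] \<open>y = log_differential g x\<close> show ?thesis
    by (simp add: potential_def dual_potential_def ln_div)
qed

end
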